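(* Let $0\le k\le n$ and $f\in\widetilde S_n$. Then $f\in T\operatorname{Bound}(k,n)$ if and only if every row of $D(f)$ has at most $n-k$ cells and every column of $D(f)$ has at most $k$ cells.
   Context: $\widetilde S_n$ is the group of bijections $f:\mathbb{Z}\to\mathbb{Z}$ with $f(i+n)=f(i)+n$; $\tau(i)=i+1$ and $T=\{\tau^j:j\in\mathbb{Z}\}$. $\operatorname{Bound}(k,n)$ is the set of $f$ with $i\le f(i)\le i+n$ for all $i$ and exactly $k$ of $f(1),\dots,f(n)$ exceeding $n$; $T\operatorname{Bound}(k,n)=\{\tau^jg: j\in\mathbb{Z}, g\in\operatorname{Bound}(k,n)\}$. The Rothe diagram is $D(f)=\{(i,f(j))\in\mathbb{Z}^2/\mathbb{Z}(n,n): i<j,\ f(i)>f(j)\}$; row $i$ of $D(f)$ consists of the cells having a representative with first coordinate $i$, and column $j$ of those having a representative with second coordinate $j$. *)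

theory Defs
  imports "HOL-Algebra.Group"
begin

definition affine_sym :: "nat \<Rightarrow> (int \<Rightarrow> int) monoid" where
  "affine_sym n =
     \<lparr>carrier = {f. bij f \<and> (\<forall>i. f (i + int n) = f i + int n)}, mult = (\<circ>), one = id\<rparr>"

definition tau :: "int \<Rightarrow> int" where
  "tau i = i + 1"

definition Bound :: "nat \<Rightarrow> nat \<Rightarrow> (int \<Rightarrow> int) set" where
  "Bound k n = {f \<in> carrier (affine_sym n).
     (\<forall>i. i \<le> f i \<and> f i \<le> i + int n) \<and> card {i \<in> {1..int n}. f i > int n} = k}"

definition TBound :: "nat \<Rightarrow> nat \<Rightarrow> (int \<Rightarrow> int) set" where
  "TBound k n = {(tau [^]\<^bsub>affine_sym n\<^esub> j) \<otimes>\<^bsub>affine_sym n\<^esub> g | (j::int) g. g \<in> Bound k n}"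

definition diag_rel :: "nat \<Rightarrow> ((int \<times> int) \<times> (int \<times> int)) set" where
  "diag_rel n = {((a, b), (c, d)). \<exists>m::int. c = a + m * int n \<and> d = b + m * int n}"

text \<open>Cells are elements of the quotient of \<open>\<int>\<^sup>2\<close> by \<open>\<int>(n, n)\<close>, i.e. equivalence classes of integer points.\<close>

definition Rothe :: "nat \<Rightarrow> (int \<Rightarrow> int) \<Rightarrow> (int \<times> int) set set" where
  "Rothe n f = {diag_rel n `` {(i, f j)} | i j. i < j \<and> f i > f j}"

definition Rothe_row :: "nat \<Rightarrow> (int \<Rightarrow> int) \<Rightarrow> int \<Rightarrow> (int \<times> int) set set" where
  "Rothe_row n f i = {C \<in> Rothe n f. \<exists>b. (i, b) \<in> C}"

definition Rothe_col :: "nat \<Rightarrow> (int \<Rightarrow> int) \<Rightarrow> int \<Rightarrow> (int \<times> int) set set" where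
  "Rothe_col n f j = {C \<in> Rothe n f. \<exists>a. (a, j) \<in> C}"

lemma equiv_diag_rel: "equiv UNIV (diag_rel n)"
proof (rule equivI)
  show "diag_rel n \<subseteq> UNIV \<times> UNIV" by simp
  show "refl (diag_rel n)"
    by (auto simp: refl_on_def diag_rel_def intro: exI[of _ 0])
  show "sym (diag_rel n)"
  proof (rule symI)
    fix p q assume "(p, q) \<in> diag_rel n"
    then obtain m where "fst q = fst p + m * int n" "snd q = snd p + m * int n"
      by (fastforce simp: diag_rel_def)
    then show "(q, p) \<in> diag_rel n"
      by (auto simp: diag_rel_def case_prod_beta intro!: exI[of _ "- m"])
  qed
  show "trans (diag_rel n)"
  proof (rule transI)
    fix p q r assume pq: "(p, q) \<in> diag_rel n" and qr: "(q, r) \<in> diag_rel n"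
    from pq obtain m where "fst q = fst p + m * int n" "snd q = snd p + m * int n"
      by (fastforce simp: diag_rel_def)
    moreover from qr obtain m' where "fst r = fst q + m' * int n" "snd r = snd q + m' * int n"
      by (fastforce simp: diag_rel_def)
    ultimately show "(p, r) \<in> diag_rel n"
      by (auto simp: diag_rel_def case_prod_beta algebra_simps intro!: exI[of _ "m + m'"])
  qed
qed

lemma group_affine_sym: "group (affine_sym n)"
proof (rule groupI)
  fix f assume f: "f \<in> carrier (affine_sym n)"
  then have b: "bij f" and p: "\<And>i. f (i + int n) = f i + int n"
    by (auto simp: affine_sym_def)
  have "inv_into UNIV f (i + int n) = inv_into UNIV f i + int n" for i
    using b p by (metis bij_inv_eq_iff)
  then show "\<exists>g\<in>carrier (affine_sym n). g \<otimes>\<^bsub>affine_sym n\<^esub> f = \<one>\<^bsub>affine_sym n\<^esub>"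
    using b by (intro bexI[of _ "inv_into UNIV f"])
      (auto simp: affine_sym_def bij_imp_bij_inv bij_is_inj)
qed (auto simp: affine_sym_def bij_comp comp_assoc)

lemma tau_in_affine_sym: "tau \<in> carrier (affine_sym n)"
proof -
  have "bij tau"
    by (rule bij_betw_byWitness[of _ "\<lambda>i. i - 1"]) (auto simp: tau_def)
  then show ?thesis by (auto simp: affine_sym_def tau_def)
qed

lemma tau_int_pow: "tau [^]\<^bsub>affine_sym n\<^esub> (j::int) = (\<lambda>i. i + j)"
proof -
  interpret group "affine_sym n" by (rule group_affine_sym)
  have nat_case: "tau [^]\<^bsub>affine_sym n\<^esub> (m::nat) = (\<lambda>i. i + int m)" for m
    by (induction m) (auto simp: affine_sym_def tau_def fun_eq_iff)
  have shift: "(\<lambda>i. i + c) \<in> carrier (affine_sym n)" for c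
  proof -
    have "bij (\<lambda>i::int. i + c)"
      by (rule bij_betw_byWitness[of _ "\<lambda>i. i - c"]) auto
    then show ?thesis by (auto simp: affine_sym_def)
  qed
  have "inv\<^bsub>affine_sym n\<^esub> (\<lambda>i. i + c) = (\<lambda>i. i - c)" for c
    using shift[of c] shift[of "- c"]
    by (intro inv_equality) (auto simp: affine_sym_def fun_eq_iff)
  from this[of "- j"] show ?thesis
    by (auto simp: int_pow_def2 nat_case)
qed

end

theory Submission
  imports Defs
begin

text \<open>
  For a bijection \<open>f\<close> of \<open>\<int>\<close> let \<open>A(i, v) = #{m \<le> i. f m > v} - #{m > i. f m \<le> v}\<close>. Raising \<open>i\<close> by one
  raises \<open>A\<close> by one, and raising \<open>v\<close> by one lowers it by one, so \<open>A(i, v) = a + i - v\<close> for a constant \<open>a\<close>.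
  The cells of \<open>D(f)\<close> in row \<open>i\<close> correspond to the \<open>j > i\<close> with \<open>f j < f i\<close>, those in column \<open>f i\<close> to
  the \<open>j < i\<close> with \<open>f j > f i\<close>; if \<open>r\<close> and \<open>c\<close> are their numbers, then \<open>v = f i\<close> gives
  \<open>f i - i - a = r - c\<close>. When \<open>r \<le> n - k\<close> and \<open>c \<le> k\<close>, this places \<open>f i - (a - k)\<close> between \<open>i\<close> and
  \<open>i + n\<close>. Conversely, for \<open>f\<close> in \<open>Bound(k, n)\<close> we have \<open>a = k\<close>; column \<open>b\<close> injects into
  \<open>{m \<le> b. f m > b}\<close>, of size \<open>A(b, b) = k\<close>, and row \<open>i\<close> into \<open>{m > i. f m \<le> i + n}\<close>, of size
  \<open>- A(i, i + n) = n - k\<close>.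
\<close>

section \<open>Inversions and crossings\<close>

definition row_inversions :: "(int \<Rightarrow> int) \<Rightarrow> int \<Rightarrow> int set" where
  "row_inversions f i = {j. i < j \<and> f j < f i}"

text \<open>Indexed by the position \<open>j\<close>; the corresponding column of the diagram is
  \<open>f j\<close>.\<close>

definition col_inversions :: "(int \<Rightarrow> int) \<Rightarrow> int \<Rightarrow> int set" where
  "col_inversions f j = {i. i < j \<and> f j < f i}"

definition up_cross :: "(int \<Rightarrow> int) \<Rightarrow> int \<Rightarrow> int \<Rightarrow> int set" where
  "up_cross f i v = {m. m \<le> i \<and> v < f m}"

definition down_cross :: "(int \<Rightarrow> int) \<Rightarrow> int \<Rightarrow> int \<Rightarrow> int set" where
  "down_cross f i v = {m. i < m \<and> f m \<le> v}"

text \<open>This is \<open>A(i, v)\<close>. As \<open>card\<close> is 0 on infinite sets, it has its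
  intended meaning only when both sets are finite.\<close>

definition flow :: "(int \<Rightarrow> int) \<Rightarrow> int \<Rightarrow> int \<Rightarrow> int" where
  "flow f i v = int (card (up_cross f i v)) - int (card (down_cross f i v))"

section \<open>Diagram cells as inversions\<close>

lemma affine_sym_shift_multiple:
  assumes "f \<in> carrier (affine_sym n)"
  shows "f (i + m * int n) = f i + m * int n"
proof -
  have p: "f (i + int n) = f i + int n" for i
    using assms by (simp add: affine_sym_def)
  show ?thesis
  proof (induction m rule: int_induct[where k = 0])
    case (step1 m)
    then show ?case using p[of "i + m * int n"] by (simp add: algebra_simps)
  next
    case (step2 m)
    then show ?case using p[of "i + (m - 1) * int n"] by (simp add: algebra_simps)
  qed simp
qed

lemma diag_rel_class_eq_iff:
  "diag_rel n `` {(a, b)} = diag_rel n `` {(c, d)} \<longleftrightarrow>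
    (\<exists>m. c = a + m * int n \<and> d = b + m * int n)"
  using eq_equiv_class_iff[OF equiv_diag_rel, of "(a, b)" "(c, d)" n] by (auto simp: diag_rel_def)

lemma mem_diag_rel_class_iff:
  "(c, d) \<in> diag_rel n `` {(a, b)} \<longleftrightarrow> (\<exists>m. c = a + m * int n \<and> d = b + m * int n)"
  by (auto simp: diag_rel_def)

text \<open>Periodicity moves any cell of row \<open>i\<close> to a representative
  \<open>(i, f j)\<close>; the first coordinate fixes the shift, so \<open>f j\<close> and hence
  \<open>j\<close> is unique.\<close>

lemma Rothe_row_bij:
  assumes f: "f \<in> carrier (affine_sym n)"
  shows "bij_betw (\<lambda>j. diag_rel n `` {(i, f j)}) (row_inversions f i) (Rothe_row n f i)"
proof (rule bij_betw_imageI)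
  have inj: "inj f" using f by (simp add: affine_sym_def bij_is_inj)
  show "inj_on (\<lambda>j. diag_rel n `` {(i, f j)}) (row_inversions f i)"
    by (rule inj_onI) (auto simp: diag_rel_class_eq_iff dest: injD[OF inj])
  show "(\<lambda>j. diag_rel n `` {(i, f j)}) ` row_inversions f i = Rothe_row n f i"
  proof (intro equalityI subsetI)
    fix C assume "C \<in> (\<lambda>j. diag_rel n `` {(i, f j)}) ` row_inversions f i"
    then obtain j where j: "i < j" "f j < f i" and C: "C = diag_rel n `` {(i, f j)}"
      by (auto simp: row_inversions_def)
    have "(i, f j) \<in> C" unfolding C mem_diag_rel_class_iff by (rule exI[of _ 0]) simp
    with j C show "C \<in> Rothe_row n f i" unfolding Rothe_row_def Rothe_def by blast
  next
    fix C assume "C \<in> Rothe_row n f i"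
    then obtain i' j b where ij: "i' < j" "f j < f i'" and C: "C = diag_rel n `` {(i', f j)}"
      and b: "(i, b) \<in> C"
      by (auto simp: Rothe_row_def Rothe_def)
    from b obtain m where m: "i = i' + m * int n" unfolding C mem_diag_rel_class_iff by blast
    note sh = affine_sym_shift_multiple[OF f, of _ m]
    have "C = diag_rel n `` {(i, f (j + m * int n))}"
      unfolding C diag_rel_class_eq_iff using m sh by blast
    moreover have "j + m * int n \<in> row_inversions f i"
      using ij by (simp add: row_inversions_def m sh)
    ultimately show "C \<in> (\<lambda>j. diag_rel n `` {(i, f j)}) ` row_inversions f i" by blast
  qed
qed

lemma Rothe_col_bij:
  assumes f: "f \<in> carrier (affine_sym n)"
  shows "bij_betw (\<lambda>i. diag_rel n `` {(i, f j)}) (col_inversions f j) (Rothe_col n f (f j))"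
proof (rule bij_betw_imageI)
  have inj: "inj f" using f by (simp add: affine_sym_def bij_is_inj)
  show "inj_on (\<lambda>i. diag_rel n `` {(i, f j)}) (col_inversions f j)"
    by (rule inj_onI) (auto simp: diag_rel_class_eq_iff)
  show "(\<lambda>i. diag_rel n `` {(i, f j)}) ` col_inversions f j = Rothe_col n f (f j)"
  proof (intro equalityI subsetI)
    fix C assume "C \<in> (\<lambda>i. diag_rel n `` {(i, f j)}) ` col_inversions f j"
    then obtain i where i: "i < j" "f j < f i" and C: "C = diag_rel n `` {(i, f j)}"
      by (auto simp: col_inversions_def)
    have "(i, f j) \<in> C" unfolding C mem_diag_rel_class_iff by (rule exI[of _ 0]) simp
    with i C show "C \<in> Rothe_col n f (f j)" unfolding Rothe_col_def Rothe_def by blast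
  next
    fix C assume "C \<in> Rothe_col n f (f j)"
    then obtain i j' a where ij: "i < j'" "f j' < f i" and C: "C = diag_rel n `` {(i, f j')}"
      and a: "(a, f j) \<in> C"
      by (auto simp: Rothe_col_def Rothe_def)
    from a obtain m where m: "f j = f j' + m * int n" unfolding C mem_diag_rel_class_iff by blast
    note sh = affine_sym_shift_multiple[OF f, of _ m]
    \<comment> \<open>Periodicity and injectivity of \<open>f\<close> carry the shift from values
      back to positions.\<close>
    have j: "j = j' + m * int n" using m sh[of j'] injD[OF inj] by metis
    have "C = diag_rel n `` {(i + m * int n, f j)}"
      unfolding C diag_rel_class_eq_iff using m by blast
    moreover have "i + m * int n \<in> col_inversions f j"
      using ij by (simp add: col_inversions_def j sh)
    ultimately show "C \<in> (\<lambda>i. diag_rel n `` {(i, f j)}) ` col_inversions f j" by blast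
  qed
qed

section \<open>Finiteness and linearity of the flow\<close>

lemma finite_up_cross:
  assumes "inj f" "finite (col_inversions f i)"
  shows "finite (up_cross f i v)"
proof (rule finite_subset)
  \<comment> \<open>Values at most \<open>f i\<close> lie in a finite interval; larger ones at
    positions up to \<open>i\<close> occur only at inversions with \<open>i\<close>.\<close>
  show "up_cross f i v \<subseteq> f -` {v<..f i} \<union> col_inversions f i"
  proof
    fix m assume m: "m \<in> up_cross f i v"
    then show "m \<in> f -` {v<..f i} \<union> col_inversions f i"
      by (cases "m = i") (auto simp: up_cross_def col_inversions_def)
  qed
  show "finite (f -` {v<..f i} \<union> col_inversions f i)"
    using assms by (simp add: finite_vimageI)
qed

lemma finite_down_cross:
  assumes "inj f" "finite (row_inversions f i)"
  shows "finite (down_cross f i v)"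
proof (rule finite_subset)
  show "down_cross f i v \<subseteq> f -` {f i..v} \<union> row_inversions f i"
    by (auto simp: down_cross_def row_inversions_def)
  show "finite (f -` {f i..v} \<union> row_inversions f i)"
    using assms by (simp add: finite_vimageI)
qed

lemma int_arith_progression:
  fixes h :: "int \<Rightarrow> int"
  assumes "\<And>i. h (i + 1) = h i + c"
  shows "h i = h 0 + i * c"
proof (induction i rule: int_induct[where k = 0])
  case (step1 i)
  then show ?case using assms[of i] by (simp add: algebra_simps)
next
  case (step2 i)
  then show ?case using assms[of "i - 1"] by (simp add: algebra_simps)
qed simp

text \<open>Only the position \<open>i + 1\<close> changes sides: it either enters
  \<open>up_cross\<close> or leaves \<open>down_cross\<close>, and both raise the difference by
  one.\<close>

lemma flow_Suc_position:
  assumes "finite (up_cross f i v)" "finite (down_cross f (i + 1) v)"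
  shows "flow f (i + 1) v = flow f i v + 1"
proof -
  have le: "x \<le> i + 1 \<longleftrightarrow> x = i + 1 \<or> x \<le> i" for x by linarith
  have gt: "i < x \<longleftrightarrow> x = i + 1 \<or> i + 1 < x" for x by linarith
  have notin: "i + 1 \<notin> up_cross f i v" "i + 1 \<notin> down_cross f (i + 1) v"
    by (simp_all add: up_cross_def down_cross_def)
  show ?thesis
  proof (cases "v < f (i + 1)")
    case True
    then have "up_cross f (i + 1) v = insert (i + 1) (up_cross f i v)"
      unfolding up_cross_def le by blast
    moreover have "down_cross f i v = down_cross f (i + 1) v"
      using True gt unfolding down_cross_def by (metis linorder_not_le)
    ultimately show ?thesis using assms notin by (simp add: flow_def)
  next
    case False
    then have "down_cross f i v = insert (i + 1) (down_cross f (i + 1) v)"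
      unfolding down_cross_def gt not_less by blast
    moreover have "up_cross f (i + 1) v = up_cross f i v"
      using False unfolding up_cross_def le by blast
    ultimately show ?thesis using assms notin by (simp add: flow_def)
  qed
qed

text \<open>Only the preimage \<open>m\<close> of \<open>v + 1\<close> is affected: it leaves
  \<open>up_cross\<close> if \<open>m \<le> i\<close> and enters \<open>down_cross\<close>
  otherwise.\<close>

lemma flow_Suc_value:
  assumes "bij f" "finite (up_cross f i (v + 1))" "finite (down_cross f i v)"
  shows "flow f i (v + 1) = flow f i v - 1"
proof -
  obtain m where m: "\<And>x. f x = v + 1 \<longleftrightarrow> x = m"
    using bij_pointE[OF assms(1), of "v + 1"] by metis
  have gt: "v < f x \<longleftrightarrow> x = m \<or> v + 1 < f x" for x
    using m[of x] by linarith
  have le: "f x \<le> v + 1 \<longleftrightarrow> x = m \<or> f x \<le> v" for x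
    using m[of x] by linarith
  have fm: "f m = v + 1" using m by simp
  show ?thesis
  proof (cases "m \<le> i")
    case True
    then have "up_cross f i v = insert m (up_cross f i (v + 1))"
      using gt by (auto simp: up_cross_def)
    moreover have "m \<notin> up_cross f i (v + 1)" by (simp add: up_cross_def fm)
    moreover have "down_cross f i (v + 1) = down_cross f i v"
      using le True by (auto simp: down_cross_def)
    ultimately show ?thesis using assms by (simp add: flow_def)
  next
    case False
    then have "down_cross f i (v + 1) = insert m (down_cross f i v)"
      using le by (auto simp: down_cross_def)
    moreover have "m \<notin> down_cross f i v" by (simp add: down_cross_def fm)
    moreover have "up_cross f i (v + 1) = up_cross f i v"
      using gt False by (auto simp: up_cross_def)
    ultimately show ?thesis using assms by (simp add: flow_def)
  qed
qed

lemma flow_eq: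
  assumes "bij f" "\<And>i v. finite (up_cross f i v)" "\<And>i v. finite (down_cross f i v)"
  shows "flow f i v = flow f 0 0 + i - v"
proof -
  have "flow f i v = flow f 0 v + i"
    using int_arith_progression[of "\<lambda>i. flow f i v" 1 i, OF flow_Suc_position[OF assms(2,3)]] by simp
  moreover have "flow f 0 v = flow f 0 0 - v"
    using int_arith_progression[of "flow f 0" "-1" v] flow_Suc_value[OF assms] by simp
  ultimately show ?thesis by simp
qed

lemma flow_diagonal:
  assumes "inj f"
  shows "flow f i (f i) = int (card (col_inversions f i)) - int (card (row_inversions f i))"
proof -
  have "up_cross f i (f i) = col_inversions f i"
    by (auto simp: up_cross_def col_inversions_def order_le_less)
  \<comment> \<open>For \<open>m > i\<close>, injectivity makes \<open>f m \<le> f i\<close>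
    strict.\<close>
  moreover have "down_cross f i (f i) = row_inversions f i"
    using injD[OF assms] by (fastforce simp: down_cross_def row_inversions_def order_le_less)
  ultimately show ?thesis by (simp add: flow_def)
qed

section \<open>Inversion bounds for Bound(k, n)\<close>

lemma Bound_inversions:
  assumes "k \<le> n" "g \<in> Bound k n"
  shows "finite (row_inversions g i)" "card (row_inversions g i) \<le> n - k"
    and "finite (col_inversions g i)" "card (col_inversions g i) \<le> k"
proof -
  have bij: "bij g" and lo: "\<And>i. i \<le> g i" and hi: "\<And>i. g i \<le> i + int n"
    and card: "card {i \<in> {1..int n}. g i > int n} = k"
    using assms(2) by (auto simp: Bound_def affine_sym_def)
  have fin_up: "finite (up_cross g i v)" for i v
  proof (rule finite_subset)
    show "up_cross g i v \<subseteq> {v - int n..i}"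
    proof
      fix x assume "x \<in> up_cross g i v"
      then show "x \<in> {v - int n..i}" using hi[of x] by (simp add: up_cross_def)
    qed
  qed simp
  have fin_down: "finite (down_cross g i v)" for i v
  proof (rule finite_subset)
    show "down_cross g i v \<subseteq> {i..v}"
    proof
      fix x assume "x \<in> down_cross g i v"
      then show "x \<in> {i..v}" using lo[of x] by (simp add: down_cross_def)
    qed
  qed simp
  note fl = flow_eq[OF bij fin_up fin_down]
  have down_empty: "down_cross g i i = {}" for i
    using order.trans[OF lo] by (auto simp: down_cross_def not_less[symmetric])
  have up_empty: "up_cross g i (i + int n) = {}" for i
  proof -
    have "\<not> i + int n < g x" if "x \<le> i" for x using hi[of x] that by linarith
    then show ?thesis by (auto simp: up_cross_def)
  qed
  \<comment> \<open>A value above \<open>n\<close> at \<open>x\<close> forces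
    \<open>x \<ge> 1\<close>, because \<open>g x \<le> x + n\<close>. So the count in
    \<open>Bound\<close> covers all of \<open>up_cross\<close>, which fixes the constant of the flow
    as \<open>k\<close>.\<close>
  have "up_cross g (int n) (int n) = {i \<in> {1..int n}. g i > int n}"
  proof -
    have "1 \<le> x" if "int n < g x" for x using hi[of x] that by linarith
    then show ?thesis by (auto simp: up_cross_def)
  qed
  then have a: "flow g 0 0 = int k"
    using fl[of "int n" "int n"] card by (simp add: flow_def down_empty)
  have card_up: "card (up_cross g b b) = k" for b
    using fl[of b b] a by (simp add: flow_def down_empty)
  \<comment> \<open>The flow here is \<open>k - n\<close> and comes from down crossings alone;
    \<open>k \<le> n\<close> makes the natural subtraction exact.\<close>
  have card_down: "card (down_cross g i (i + int n)) = n - k" for i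
    using fl[of i "i + int n"] a assms(1) by (simp add: flow_def up_empty)
  have row: "row_inversions g i \<subseteq> down_cross g i (i + int n)"
    using hi[of i] by (auto simp: row_inversions_def down_cross_def)
  \<comment> \<open>The cut is at \<open>g i\<close> in both arguments: \<open>x < i\<close> gives
    \<open>x \<le> g i\<close>.\<close>
  have col: "col_inversions g i \<subseteq> up_cross g (g i) (g i)"
    using lo[of i] by (auto simp: col_inversions_def up_cross_def)
  show "finite (row_inversions g i)" "card (row_inversions g i) \<le> n - k"
    using finite_subset[OF row fin_down] card_mono[OF fin_down row] card_down by auto
  show "finite (col_inversions g i)" "card (col_inversions g i) \<le> k"
    using finite_subset[OF col fin_up] card_mono[OF fin_up col] card_up by auto
qed

section \<open>Translating into Bound(k, n)\<close>

lemma affine_sym_translate: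
  assumes "f \<in> carrier (affine_sym n)"
  shows "(\<lambda>i. f i + c) \<in> carrier (affine_sym n)"
proof -
  have "bij (\<lambda>x::int. x + c)"
    by (rule bij_betw_byWitness[of _ "\<lambda>i. i - c"]) auto
  then have "bij ((\<lambda>x. x + c) \<circ> f)"
    using assms by (intro bij_comp) (auto simp: affine_sym_def)
  with assms show ?thesis by (auto simp: affine_sym_def comp_def)
qed

text \<open>The shift changes the constant of the flow from \<open>flow f 0 0\<close> to
  \<open>k\<close>, the value it must have in \<open>Bound k n\<close>.\<close>

lemma inversions_bounded_imp_translate_in_Bound:
  assumes "k \<le> n" and f: "f \<in> carrier (affine_sym n)"
    and row: "\<And>i. finite (row_inversions f i)" "\<And>i. card (row_inversions f i) \<le> n - k"
    and col: "\<And>i. finite (col_inversions f i)" "\<And>i. card (col_inversions f i) \<le> k"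
  shows "(\<lambda>i. f i + (int k - flow f 0 0)) \<in> Bound k n"
proof -
  define a where "a = flow f 0 0"
  define g where "g = (\<lambda>i. f i + (int k - a))"
  have bij: "bij f" using f by (simp add: affine_sym_def)
  note inj = bij_is_inj[OF bij]
  have fl: "flow f i v = a + i - v" for i v
    unfolding a_def
    using flow_eq[OF bij finite_up_cross[OF inj col(1)] finite_down_cross[OF inj row(1)]] .
  have disp: "g i = i + int k + int (card (row_inversions f i)) - int (card (col_inversions f i))" for i
    using fl[of i "f i"] flow_diagonal[OF inj, of i] by (simp add: g_def)
  have lo: "i \<le> g i" for i
    using disp[of i] col(2)[of i] by linarith
  have hi: "g i \<le> i + int n" for i
    using disp[of i] row(2)[of i] assms(1) by linarith
  \<comment> \<open>The level of \<open>f\<close> that the shift moves to \<open>n\<close>. The up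
    crossings there are those counted in \<open>Bound\<close>, none go down since
    \<open>x \<le> g x\<close>, and the flow is \<open>k\<close>.\<close>
  let ?v = "int n - (int k - a)"
  have v: "v < f i + (int k - a) \<longleftrightarrow> v - (int k - a) < f i"
    "f i + (int k - a) \<le> v \<longleftrightarrow> f i \<le> v - (int k - a)" for v i
    by linarith+
  have "1 \<le> x" if "int n < g x" for x using hi[of x] that by linarith
  then have up: "up_cross f (int n) ?v = {i \<in> {1..int n}. g i > int n}"
    unfolding up_cross_def by (auto simp: g_def v)
  have "\<not> g x \<le> int n" if "int n < x" for x using lo[of x] that by linarith
  then have down: "down_cross f (int n) ?v = {}"
    unfolding down_cross_def by (auto simp: g_def v)
  have "card {i \<in> {1..int n}. g i > int n} = k"
    using fl[of "int n" ?v] by (simp add: flow_def up down)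
  moreover have "g \<in> carrier (affine_sym n)"
    unfolding g_def by (rule affine_sym_translate[OF f])
  ultimately show ?thesis
    using lo hi unfolding Bound_def a_def[symmetric] g_def[symmetric] by simp
qed

text \<open>Left multiplication by a power of \<open>tau\<close> adds its exponent to all values;
  \<open>c\<close> is the negative of that exponent.\<close>

lemma TBound_iff: "f \<in> TBound k n \<longleftrightarrow> (\<exists>c. (\<lambda>i. f i + c) \<in> Bound k n)"
proof
  assume "f \<in> TBound k n"
  then obtain j g where "f = (\<lambda>i. g i + j)" "g \<in> Bound k n"
    unfolding TBound_def tau_int_pow by (auto simp: affine_sym_def comp_def)
  then show "\<exists>c. (\<lambda>i. f i + c) \<in> Bound k n"
    by (intro exI[of _ "- j"]) simp
next
  assume "\<exists>c. (\<lambda>i. f i + c) \<in> Bound k n"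
  then obtain c where c: "(\<lambda>i. f i + c) \<in> Bound k n" ..
  have "f = (\<lambda>i. i + - c) \<otimes>\<^bsub>affine_sym n\<^esub> (\<lambda>i. f i + c)"
    by (simp add: affine_sym_def comp_def)
  with c show "f \<in> TBound k n"
    unfolding TBound_def tau_int_pow by blast
qed

text \<open>Finiteness accompanies each bound because \<open>card\<close> is 0 on infinite
  sets.\<close>

theorem theorem2p20:
  fixes k n :: nat and f :: "int \<Rightarrow> int"
  assumes "k \<le> n" and "f \<in> carrier (affine_sym n)"
  shows "f \<in> TBound k n \<longleftrightarrow>
    (\<forall>i. finite (Rothe_row n f i) \<and> card (Rothe_row n f i) \<le> n - k) \<and>
    (\<forall>j. finite (Rothe_col n f j) \<and> card (Rothe_col n f j) \<le> k)"
proof -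
  note row = Rothe_row_bij[OF assms(2)] and col = Rothe_col_bij[OF assms(2)]
  \<comment> \<open>The column bijection concerns columns of the form \<open>f i\<close>;
    surjectivity makes these all columns.\<close>
  have surj: "(\<forall>j. P j) \<longleftrightarrow> (\<forall>i. P (f i))" for P
    using assms(2) by (auto simp: affine_sym_def) (metis bij_pointE)
  have "f \<in> TBound k n \<longleftrightarrow>
    (\<forall>i. finite (row_inversions f i) \<and> card (row_inversions f i) \<le> n - k) \<and>
    (\<forall>i. finite (col_inversions f i) \<and> card (col_inversions f i) \<le> k)" (is "_ \<longleftrightarrow> ?R")
  proof
    assume "f \<in> TBound k n"
    then obtain c where c: "(\<lambda>i. f i + c) \<in> Bound k n" by (auto simp: TBound_iff)
    \<comment> \<open>Adding a constant preserves every comparison of values.\<close>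
    have "row_inversions (\<lambda>i. f i + c) = row_inversions f"
      "col_inversions (\<lambda>i. f i + c) = col_inversions f"
      by (simp_all add: row_inversions_def col_inversions_def fun_eq_iff)
    with Bound_inversions[OF assms(1) c] show ?R by simp
  next
    assume ?R
    then show "f \<in> TBound k n"
      using inversions_bounded_imp_translate_in_Bound[OF assms] unfolding TBound_iff by blast
  qed
  then show ?thesis
    unfolding surj[of "\<lambda>j. finite (Rothe_col n f j) \<and> card (Rothe_col n f j) \<le> k"]
    using bij_betw_finite[OF row] bij_betw_same_card[OF row]
      bij_betw_finite[OF col] bij_betw_same_card[OF col] by simp
qed

end
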